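(* Let $\widehat X$ be a stationary Poisson hyperplane process in $\mathbb{R}^d$ whose intensity measure $\widehat\Theta$ is locally finite and not identically zero, let $\widehat\varphi$ be its spherical directional distribution, and let $X$ be the mosaic (set of cells) induced by $\widehat X$. Let $c$ be a center function, let $\mathcal{K}^d_0=\{K\in\mathcal{K}^d: c(K)=0\}$, and let $\mathbb{Q}^{(d)}$ be the distribution of the typical cell of $X$ (a Borel probability measure on $\mathcal{K}^d_0$). Assume (A) the support of $\widehat\varphi$ is the whole unit sphere $\mathbb{S}^{d-1}$. Then the support of $\mathbb{Q}^{(d)}$ is the whole space $\mathcal{K}^d_0$.
   Context: $\mathcal{K}^d$ is the set of convex bodies (nonempty, compact, convex subsets) of $\mathbb{R}^d$, with the topology induced by the Hausdorff metric $\delta(K,L)=\min\{\eta\ge 0: K\subset L+\eta B^d,\ L\subset K+\eta B^d\}$, where $B^d$ is the closed unit ball; $\mathcal{B}(\mathcal{K}^d)$ is its Borel $\sigma$-algebra, and $\mathcal{K}^d_0$ carries the subspace topology. $\mathcal{H}^d$ is the space of (affine) hyperplanes in $\mathbb{R}^d$ with its usual topology and Borel $\sigma$-algebra $\mathcal{B}(\mathcal{H}^d)$. A stationary Poisson hyperplane process $\widehat X$ is a Poisson point process in $\mathcal{H}^d$ whose distribution is invariant under translations of $\mathbb{R}^d$. Realizations are identified with locally finite systems of hyperplanes (every bounded subset of $\mathbb{R}^d$ is met by only finitely many of them). Its intensity measure is $\widehat\Theta(A)=\mathbb{E}|\widehat X\cap A|$ for $A\in\mathcal{B}(\mathcal{H}^d)$,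 where $|\cdot|$ is the number of elements. The Poisson property means: $\mathbb{P}\{|\widehat X\cap A|=n\}=e^{-\widehat\Theta(A)}\widehat\Theta(A)^n/n!$ for $n\in\mathbb{N}_0$ whenever $\widehat\Theta(A)<\infty$, and the restrictions of $\widehat X$ to pairwise disjoint Borel sets are independent. By stationarity there are a number $\widehat\gamma>0$ and an even Borel probability measure $\widehat\varphi$ on the unit sphere $\mathbb{S}^{d-1}$, called the spherical directional distribution of $\widehat X$, such that $$\widehat\Theta(A)=\widehat\gamma\int_{\mathbb{S}^{d-1}}\int_{-\infty}^{\infty}\mathbf{1}_A(u^\perp+\tau u)\,d\tau\,\widehat\varphi(du),\qquad A\in\mathcal{B}(\mathcal{H}^d),$$ where $u^\perp$ is the hyperplane through $0$ orthogonal to $u$. The cells induced by a locally finite system $\mathcal{H}$ of hyperplanes are the closures of the connected components of $\mathbb{R}^d\setminus\bigcup_{H\in\mathcal{H}}H$. The mosaic $X$ is the (random) set of all cells induced by $\widehat X$; under the assumption made, its cells are almost surely convex polytopes. A center function is a continuous function $c:\mathcal{K}^d\to\mathbb{R}^d$ that is translation covariant ($c(K+x)=c(K)+x$ for all $x\in\mathbb{R}^d$) and satisfies $c(K)\in K$ for all $K\in\mathcal{K}^d$ (for example, the center of the circumball or the Steiner point). The intensity measure of the mosaic $X$ is $\Theta^{(d)}(A)=\mathbb{E}|X\cap A|$ for $A\in\mathcal{B}(\mathcal{K}^d)$. By stationarity, there exist a number $\gamma^{(d)}>0$ and a Borel probability measure $\mathbb{Q}^{(d)}$ on $\mathcal{K}^d_0$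 such that $$\Theta^{(d)}(A)=\gamma^{(d)}\int_{\mathcal{K}^d_0}\int_{\mathbb{R}^d}\mathbf{1}_A(C+x)\,\lambda(dx)\,\mathbb{Q}^{(d)}(dC),\qquad A\in\mathcal{B}(\mathcal{K}^d),$$ where $\lambda$ is Lebesgue measure on $\mathbb{R}^d$. The typical cell of $X$ is a random polytope with distribution $\mathbb{Q}^{(d)}$. *)

theory Defs
  imports "HOL-Probability.Probability"
begin

section \<open>Borel sets and supports for abstract topologies\<close>

definition borel_of :: "'b topology \<Rightarrow> 'b measure" where
  "borel_of T = sigma (topspace T) {U. openin T U}"

lemma space_borel_of [simp]: "space (borel_of T) = topspace T"
  by (auto simp: borel_of_def intro!: space_measure_of dest: openin_subset)

lemma sets_borel_of: "sets (borel_of T) = sigma_sets (topspace T) {U. openin T U}"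
  by (auto simp: borel_of_def intro!: sets_measure_of dest: openin_subset)

definition measure_support :: "'b topology \<Rightarrow> 'b measure \<Rightarrow> 'b set" where
  "measure_support T \<mu> =
     {x \<in> topspace T. \<forall>U. openin T U \<and> x \<in> U \<longrightarrow> 0 < emeasure \<mu> U}"

lemma measure_support_eq_Inter:
  "measure_support T \<mu> = \<Inter>{F. closedin T F \<and> emeasure \<mu> (topspace T - F) = 0}"
proof (intro subset_antisym subsetI)
  fix x assume x: "x \<in> measure_support T \<mu>"
  have "x \<in> F" if "closedin T F" "emeasure \<mu> (topspace T - F) = 0" for F
  proof (rule ccontr)
    assume "x \<notin> F"
    then have "0 < emeasure \<mu> (topspace T - F)"
      using x that(1) by (auto simp: measure_support_def closedin_def)
    then show False using that(2) by simp
  qed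
  then show "x \<in> \<Inter>{F. closedin T F \<and> emeasure \<mu> (topspace T - F) = 0}" by blast
next
  fix x assume x: "x \<in> \<Inter>{F. closedin T F \<and> emeasure \<mu> (topspace T - F) = 0}"
  have "closedin T (topspace T) \<and> emeasure \<mu> (topspace T - topspace T) = 0" by simp
  then have xT: "x \<in> topspace T" using x by blast
  have "0 < emeasure \<mu> U" if "openin T U" "x \<in> U" for U
  proof (rule ccontr)
    assume "\<not> 0 < emeasure \<mu> U"
    moreover have "topspace T - (topspace T - U) = U"
      using openin_subset[OF that(1)] by blast
    ultimately have "closedin T (topspace T - U) \<and> emeasure \<mu> (topspace T - (topspace T - U)) = 0"
      using that(1) by (simp add: closedin_diff)
    then show False using x that(2) by blast
  qed
  then show "x \<in> measure_support T \<mu>" using xT by (simp add: measure_support_def)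
qed


section \<open>Convex bodies with the Hausdorff metric\<close>

definition convex_bodies :: "'a::euclidean_space set set" where
  "convex_bodies = {K. K \<noteq> {} \<and> compact K \<and> convex K}"

definition hausdorff_radii :: "'a::euclidean_space set \<Rightarrow> 'a set \<Rightarrow> real set" where
  "hausdorff_radii K L = {\<eta>. 0 \<le> \<eta> \<and> K \<subseteq> L + (*\<^sub>R) \<eta> ` cball 0 1 \<and> L \<subseteq> K + (*\<^sub>R) \<eta> ` cball 0 1}"

text \<open>The case distinction never matters for convex bodies; it only makes the function
  nonnegative everywhere, as \<^locale>\<open>Metric_space\<close> requires.\<close>

definition hausdorff_dist :: "'a::euclidean_space set \<Rightarrow> 'a set \<Rightarrow> real" where
  "hausdorff_dist K L = (if hausdorff_radii K L = {} then 0 else Inf (hausdorff_radii K L))"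

lemma set_plus_scaled_cball_iff:
  fixes L :: "'a::euclidean_space set"
  assumes "0 \<le> \<eta>"
  shows "x \<in> L + (*\<^sub>R) \<eta> ` cball 0 1 \<longleftrightarrow> (\<exists>y\<in>L. dist x y \<le> \<eta>)"
proof -
  have "(*\<^sub>R) \<eta> ` cball 0 1 = cball (0::'a) \<eta>"
    using cball_scale[of \<eta> "0::'a" 1] assms by (cases "\<eta> = 0") (auto simp: image_constant_conv)
  then show ?thesis
    by (force simp: set_plus_def dist_norm intro: bexI[of _ "x - y" for y])
qed

lemma hausdorff_radii_iff:
  "\<eta> \<in> hausdorff_radii K L \<longleftrightarrow>
     0 \<le> \<eta> \<and> (\<forall>x\<in>K. \<exists>y\<in>L. dist x y \<le> \<eta>) \<and> (\<forall>x\<in>L. \<exists>y\<in>K. dist x y \<le> \<eta>)"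
  by (auto simp: hausdorff_radii_def subset_iff set_plus_scaled_cball_iff)

lemma hausdorff_radii_nonempty:
  assumes "K \<in> convex_bodies" "L \<in> convex_bodies"
  shows "hausdorff_radii K L \<noteq> {}"
proof -
  obtain k l where k: "k \<in> K" and l: "l \<in> L" using assms by (auto simp: convex_bodies_def)
  have "bounded (K \<union> L)" using assms by (auto simp: convex_bodies_def compact_imp_bounded)
  then obtain e where e: "\<forall>x\<in>K \<union> L. \<forall>y\<in>K \<union> L. dist x y \<le> e"
    unfolding bounded_two_points by blast
  then have "e \<in> hausdorff_radii K L"
    using k l by (auto simp: hausdorff_radii_iff intro: order_trans[OF zero_le_dist])
  then show ?thesis by blast
qed

text \<open>The infimum is attained, so \<^const>\<open>hausdorff_dist\<close> is the minimum of the admissible radii.\<close>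

lemma hausdorff_dist_in_radii:
  fixes K L :: "'a::euclidean_space set"
  assumes "K \<in> convex_bodies" "L \<in> convex_bodies"
  shows "hausdorff_dist K L \<in> hausdorff_radii K L"
proof -
  have eq: "hausdorff_dist K L = Inf (hausdorff_radii K L)"
    using hausdorff_radii_nonempty[OF assms] by (simp add: hausdorff_dist_def)
  have near: "\<exists>y\<in>B. dist x y \<le> hausdorff_dist K L"
    if B: "compact B" "B \<noteq> {}" and x: "\<And>\<eta>. \<eta> \<in> hausdorff_radii K L \<Longrightarrow> \<exists>y\<in>B. dist x y \<le> \<eta>"
    for B :: "'a set" and x
  proof -
    obtain y where y: "y \<in> B" "\<And>z. z \<in> B \<Longrightarrow> dist x y \<le> dist x z"
      by (rule distance_attains_inf[OF compact_imp_closed[OF B(1)] B(2), of x]) blast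
    have "dist x y \<le> hausdorff_dist K L"
      unfolding eq
      by (rule cInf_greatest[OF hausdorff_radii_nonempty[OF assms]]) (use x y in force)
    then show ?thesis using y(1) by blast
  qed
  have "0 \<le> hausdorff_dist K L"
    unfolding eq
    by (rule cInf_greatest[OF hausdorff_radii_nonempty[OF assms]]) (simp add: hausdorff_radii_iff)
  moreover have "\<exists>y\<in>L. dist x y \<le> hausdorff_dist K L" if "x \<in> K" for x
    by (rule near) (use that assms in \<open>auto simp: convex_bodies_def hausdorff_radii_iff\<close>)
  moreover have "\<exists>y\<in>K. dist x y \<le> hausdorff_dist K L" if "x \<in> L" for x
    by (rule near) (use that assms in \<open>auto simp: convex_bodies_def hausdorff_radii_iff\<close>)
  ultimately show ?thesis by (simp add: hausdorff_radii_iff)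
qed

lemma hausdorff_dist_le:
  "\<eta> \<in> hausdorff_radii K L \<Longrightarrow> hausdorff_dist K L \<le> \<eta>"
  unfolding hausdorff_dist_def
  by (auto intro!: cInf_lower bdd_belowI[of _ 0] simp: hausdorff_radii_iff)

lemma hausdorff_radii_commute: "hausdorff_radii K L = hausdorff_radii L K"
  by (auto simp: hausdorff_radii_def)

lemma hausdorff_dist_commute: "hausdorff_dist K L = hausdorff_dist L K"
  unfolding hausdorff_dist_def hausdorff_radii_commute[of K L] ..

interpretation Hausdorff: Metric_space "convex_bodies :: 'a::euclidean_space set set" hausdorff_dist
proof
  fix K L :: "'a set"
  show "0 \<le> hausdorff_dist K L"
    unfolding hausdorff_dist_def by (auto intro!: cInf_greatest simp: hausdorff_radii_iff)
next
  fix K L :: "'a set"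
  show "hausdorff_dist K L = hausdorff_dist L K" by (rule hausdorff_dist_commute)
next
  fix K L :: "'a set"
  assume KL: "K \<in> convex_bodies" "L \<in> convex_bodies"
  show "hausdorff_dist K L = 0 \<longleftrightarrow> K = L"
  proof
    assume "hausdorff_dist K L = 0"
    then show "K = L" using hausdorff_dist_in_radii[OF KL] by (auto simp: hausdorff_radii_iff)
  next
    assume "K = L"
    then have "0 \<in> hausdorff_radii K L" by (force simp: hausdorff_radii_iff)
    then have "hausdorff_dist K L \<le> 0" by (rule hausdorff_dist_le)
    then show "hausdorff_dist K L = 0"
      using hausdorff_dist_in_radii[OF KL] by (simp add: hausdorff_radii_iff)
  qed
next
  fix K L N :: "'a set"
  assume KLN: "K \<in> convex_bodies" "L \<in> convex_bodies" "N \<in> convex_bodies"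
  let ?a = "hausdorff_dist K L" and ?b = "hausdorff_dist L N"
  have a: "?a \<in> hausdorff_radii K L" and b: "?b \<in> hausdorff_radii L N"
    using KLN by (auto intro: hausdorff_dist_in_radii)
  have "?a + ?b \<in> hausdorff_radii K N"
    unfolding hausdorff_radii_iff
  proof (intro conjI ballI)
    show "0 \<le> ?a + ?b" using a b by (simp add: hausdorff_radii_iff)
  next
    fix x assume "x \<in> K"
    then obtain y z where "y \<in> L" "dist x y \<le> ?a" "z \<in> N" "dist y z \<le> ?b"
      using a b unfolding hausdorff_radii_iff by meson
    then show "\<exists>z\<in>N. dist x z \<le> ?a + ?b"
      by (intro bexI[of _ z]) (use dist_triangle[of x z y] in linarith)
  next
    fix x assume "x \<in> N"
    then obtain y z where "y \<in> L" "dist x y \<le> ?b" "z \<in> K" "dist y z \<le> ?a"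
      using a b unfolding hausdorff_radii_iff by meson
    then show "\<exists>z\<in>K. dist x z \<le> ?a + ?b"
      by (intro bexI[of _ z]) (use dist_triangle[of x z y] in linarith)
  qed
  then show "hausdorff_dist K N \<le> ?a + ?b" by (rule hausdorff_dist_le)
qed

definition convex_body_topology :: "'a::euclidean_space set topology" where
  "convex_body_topology = Metric_space.mtopology convex_bodies hausdorff_dist"

lemma topspace_convex_body_topology [simp]: "topspace convex_body_topology = convex_bodies"
  by (simp add: convex_body_topology_def)

definition center_function :: "('a::euclidean_space set \<Rightarrow> 'a) \<Rightarrow> bool" where
  "center_function c \<longleftrightarrow>
     continuous_map convex_body_topology euclidean c \<and>
     (\<forall>K\<in>convex_bodies. \<forall>x. c ((+) x ` K) = c K + x) \<and>
     (\<forall>K\<in>convex_bodies. c K \<in> K)"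

definition centered_bodies :: "('a::euclidean_space set \<Rightarrow> 'a) \<Rightarrow> 'a set set" where
  "centered_bodies c = {K \<in> convex_bodies. c K = 0}"

definition centered_body_topology :: "('a::euclidean_space set \<Rightarrow> 'a) \<Rightarrow> 'a set topology" where
  "centered_body_topology c = subtopology convex_body_topology (centered_bodies c)"

lemma topspace_centered_body_topology [simp]:
  "topspace (centered_body_topology c) = centered_bodies c"
  by (auto simp: centered_body_topology_def centered_bodies_def)


section \<open>The space of hyperplanes\<close>

definition hyperplane :: "'a::euclidean_space \<Rightarrow> real \<Rightarrow> 'a set" where
  "hyperplane u \<tau> = (\<lambda>x. x + \<tau> *\<^sub>R u) ` {x. u \<bullet> x = 0}"

lemma hyperplane_eq:
  assumes "norm u = 1"
  shows "hyperplane u \<tau> = {x. u \<bullet> x = \<tau>}"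
proof -
  have uu: "u \<bullet> u = 1" using assms by (simp add: norm_eq_1)
  have "x \<in> hyperplane u \<tau>" if "u \<bullet> x = \<tau>" for x
    unfolding hyperplane_def
    by (rule image_eqI[of _ _ "x - \<tau> *\<^sub>R u"]) (use that uu in \<open>auto simp: inner_diff_right\<close>)
  then show ?thesis using uu by (auto simp: hyperplane_def inner_add_right)
qed

definition hyperplanes :: "'a::euclidean_space set set" where
  "hyperplanes = {H. \<exists>a b. a \<noteq> 0 \<and> H = {x. a \<bullet> x = b}}"

lemma hyperplanes_eq: "hyperplanes = (\<lambda>(u, \<tau>). hyperplane u \<tau>) ` (sphere 0 1 \<times> UNIV)"
proof (intro subset_antisym subsetI)
  fix H :: "'a set" assume "H \<in> hyperplanes"
  then obtain a b where a: "a \<noteq> 0" and H: "H = {x. a \<bullet> x = b}"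
    by (auto simp: hyperplanes_def)
  have n: "norm (a /\<^sub>R norm a) = 1" using a by simp
  have "H = hyperplane (a /\<^sub>R norm a) (b / norm a)"
    unfolding hyperplane_eq[OF n] H using a by (auto simp: field_simps)
  with n show "H \<in> (\<lambda>(u, \<tau>). hyperplane u \<tau>) ` (sphere 0 1 \<times> UNIV)"
    by (intro image_eqI[of _ _ "(a /\<^sub>R norm a, b / norm a)"]) (auto simp: sphere_def)
next
  fix H :: "'a set" assume "H \<in> (\<lambda>(u, \<tau>). hyperplane u \<tau>) ` (sphere 0 1 \<times> UNIV)"
  then obtain u \<tau> where u: "norm u = 1" and H: "H = {x. u \<bullet> x = \<tau>}"
    by (auto simp: sphere_def hyperplane_eq)
  then have "u \<noteq> 0" by auto
  then show "H \<in> hyperplanes" using H by (auto simp: hyperplanes_def)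
qed

text \<open>The usual topology on the space of hyperplanes is the quotient topology of the
  parametrisation by unit normals and signed distances.\<close>

definition hyperplane_topology :: "'a::euclidean_space set topology" where
  "hyperplane_topology =
     topology (\<lambda>U. U \<subseteq> hyperplanes \<and>
       openin (top_of_set (sphere 0 1 \<times> UNIV)) {(u, \<tau>) \<in> sphere 0 1 \<times> UNIV. hyperplane u \<tau> \<in> U})"

lemma openin_hyperplane_topology:
  fixes U :: "'a::euclidean_space set set"
  shows "openin hyperplane_topology U \<longleftrightarrow> U \<subseteq> hyperplanes \<and>
     openin (top_of_set (sphere 0 1 \<times> UNIV)) {(u, \<tau>) \<in> sphere 0 1 \<times> UNIV. hyperplane u \<tau> \<in> U}"
proof -
  let ?P = "\<lambda>U. {(u::'a, \<tau>) \<in> sphere 0 1 \<times> UNIV. hyperplane u \<tau> \<in> U}"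
  have Int: "?P (S \<inter> T) = ?P S \<inter> ?P T" for S T by auto
  have Un: "?P (\<Union>\<K>) = \<Union>(?P ` \<K>)" for \<K> by auto
  have "istopology (\<lambda>U. U \<subseteq> hyperplanes \<and> openin (top_of_set (sphere 0 1 \<times> UNIV)) (?P U))"
    unfolding istopology_def Int Un by (auto intro!: openin_Int openin_Union)
  then show ?thesis unfolding hyperplane_topology_def by (subst topology_inverse') auto
qed

lemma topspace_hyperplane_topology [simp]: "topspace hyperplane_topology = hyperplanes"
proof -
  have "{(u::'a, \<tau>) \<in> sphere 0 1 \<times> UNIV. hyperplane u \<tau> \<in> hyperplanes} = sphere 0 1 \<times> UNIV"
    by (auto simp: hyperplanes_eq)
  then have "openin hyperplane_topology (hyperplanes :: 'a set set)"
    unfolding openin_hyperplane_topology by auto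
  then show ?thesis
    by (intro subset_antisym) (auto simp: openin_subset topspace_def openin_hyperplane_topology)
qed

lemma quotient_map_hyperplane:
  "quotient_map (top_of_set (sphere 0 1 \<times> UNIV)) hyperplane_topology
     (\<lambda>(u::'a::euclidean_space, \<tau>). hyperplane u \<tau>)"
proof -
  have "{x \<in> sphere 0 1 \<times> UNIV. (case x of (u::'a, \<tau>) \<Rightarrow> hyperplane u \<tau>) \<in> U} =
     {(u, \<tau>) \<in> sphere 0 1 \<times> UNIV. hyperplane u \<tau> \<in> U}" for U by auto
  then show ?thesis
    by (auto simp: quotient_map_def openin_hyperplane_topology hyperplanes_eq)
qed


section \<open>Stationary Poisson hyperplane processes\<close>

definition hyperplane_systems :: "'a::euclidean_space set set set" where
  "hyperplane_systems = {S. S \<subseteq> hyperplanes \<and> (\<forall>B. bounded B \<longrightarrow> finite {H \<in> S. H \<inter> B \<noteq> {}})}"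

abbreviation num_elems :: "'b set \<Rightarrow> ennreal" where
  "num_elems \<equiv> emeasure (count_space UNIV)"

definition hyperplane_system_space :: "'a::euclidean_space set set measure" where
  "hyperplane_system_space =
     sigma hyperplane_systems
       {{S \<in> hyperplane_systems. num_elems (S \<inter> A) \<in> B} | A B.
          A \<in> sets (borel_of hyperplane_topology) \<and> B \<in> sets borel}"

definition intensity :: "'w measure \<Rightarrow> ('w \<Rightarrow> 'b set) \<Rightarrow> 'b set \<Rightarrow> ennreal" where
  "intensity M X A = (\<integral>\<^sup>+\<omega>. num_elems (X \<omega> \<inter> A) \<partial>M)"

definition translate_system :: "'a::euclidean_space \<Rightarrow> 'a set set \<Rightarrow> 'a set set" where
  "translate_system v S = (\<lambda>H. (+) v ` H) ` S"

text \<open>In the independence axiom, a family of pairwise disjoint Borel sets is indexed by itself.\<close>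

locale stationary_Poisson_hyperplane_process = prob_space M
  for M :: "'w measure" and X :: "'w \<Rightarrow> 'a::euclidean_space set set" +
  assumes process_measurable: "X \<in> M \<rightarrow>\<^sub>M hyperplane_system_space"
  and Poisson_distributed:
    "\<And>A n. A \<in> sets (borel_of hyperplane_topology) \<Longrightarrow> intensity M X A < \<infinity> \<Longrightarrow>
       \<P>(\<omega> in M. num_elems (X \<omega> \<inter> A) = of_nat n) =
         exp (- enn2real (intensity M X A)) * enn2real (intensity M X A) ^ n / fact n"
  and independent_restrictions:
    "\<And>\<A>. \<A> \<subseteq> sets (borel_of hyperplane_topology) \<Longrightarrow> disjoint \<A> \<Longrightarrow>
       indep_vars (\<lambda>_. hyperplane_system_space) (\<lambda>A \<omega>. X \<omega> \<inter> A) \<A>"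
  and stationary:
    "\<And>v. distr M hyperplane_system_space (\<lambda>\<omega>. translate_system v (X \<omega>)) =
         distr M hyperplane_system_space X"

definition locally_finite_intensity :: "'w measure \<Rightarrow> ('w \<Rightarrow> 'a::euclidean_space set set) \<Rightarrow> bool" where
  "locally_finite_intensity M X \<longleftrightarrow>
     (\<forall>A. compactin hyperplane_topology A \<longrightarrow> intensity M X A < \<infinity>)"

definition spherical_directional_distribution ::
    "'w measure \<Rightarrow> ('w \<Rightarrow> 'a::euclidean_space set set) \<Rightarrow> 'a measure \<Rightarrow> bool" where
  "spherical_directional_distribution M X \<phi> \<longleftrightarrow>
     prob_space \<phi> \<and>
     sets \<phi> = sets (borel_of (top_of_set (sphere 0 1))) \<and>
     (\<forall>A\<in>sets \<phi>. emeasure \<phi> (uminus ` A) = emeasure \<phi> A) \<and>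
     (\<exists>\<gamma>>0. \<forall>A\<in>sets (borel_of hyperplane_topology).
        intensity M X A =
          ennreal \<gamma> * (\<integral>\<^sup>+u. (\<integral>\<^sup>+\<tau>. indicator A (hyperplane u \<tau>) \<partial>lborel) \<partial>\<phi>))"


section \<open>The induced mosaic and its typical cell\<close>

text \<open>A realization may have unbounded cells. They are not convex bodies, so they never belong to
  a Borel set of convex bodies and are not counted by the intensity measure of the mosaic.\<close>

definition cells :: "'a::euclidean_space set set \<Rightarrow> 'a set set" where
  "cells S = closure ` components (UNIV - \<Union>S)"

definition typical_cell_distribution ::
    "'w measure \<Rightarrow> ('w \<Rightarrow> 'a::euclidean_space set set) \<Rightarrow> ('a set \<Rightarrow> 'a) \<Rightarrow> 'a set measure \<Rightarrow> bool" where
  "typical_cell_distribution M X c Q \<longleftrightarrow>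
     prob_space Q \<and>
     sets Q = sets (borel_of (centered_body_topology c)) \<and>
     (\<exists>\<gamma>>0. \<forall>A\<in>sets (borel_of convex_body_topology).
        intensity M X A =
          ennreal \<gamma> * (\<integral>\<^sup>+C. (\<integral>\<^sup>+x. indicator A ((+) x ` C) \<partial>lborel) \<partial>Q))"

end

theory Submission
  imports Defs
begin

text \<open>
  The intensity measure of the mosaic is the image of \<open>\<gamma> \<cdot> \<lambda> \<otimes> \<bbbQ>\<close> under \<open>(x, C) \<mapsto> C + x\<close>. Hence an
  open set \<open>U\<close> of centered bodies with \<open>\<bbbQ>(U) = 0\<close> would give intensity zero to the set \<open>A\<close> of
  all translates of members of \<open>U\<close>. As \<open>A\<close> contains a Hausdorff neighbourhood of every
  \<open>K \<in> U\<close>, it suffices to show that with positive probability the mosaic has a cell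
  within a given distance \<open>\<epsilon> > 0\<close> of a given convex body \<open>K\<close>.

  Such a cell is produced without building a polytope close to \<open>K\<close>. The level set
  \<open>{x. infdist x K = \<epsilon>}\<close> is compact, so finitely many balls \<open>L\<^sub>1, \<dots>, L\<^sub>n\<close> of radius \<open>\<epsilon>/2\<close>
  cover it, and none of them meets \<open>K\<close>. Suppose that no hyperplane of the process meets \<open>K\<close> and that
  each \<open>L\<^sub>i\<close> is strictly separated from \<open>K\<close> by some hyperplane of the process. Then \<open>K\<close>,
  being connected, lies in one component of the complement of the hyperplanes. This component misses
  every \<open>L\<^sub>i\<close>, hence misses the level set, and being connected it stays in
  \<open>{x. infdist x K < \<epsilon>}\<close>. So its closure is a cell between \<open>K\<close> and the closed
  \<open>\<epsilon>\<close>-neighbourhood of \<open>K\<close> (\<open>exists_cell_near_body\<close>).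

  It remains to see that these requirements hold with positive probability. The set \<open>B\<close> of hyperplanes
  meeting \<open>K\<close> has finite intensity. The set \<open>A\<^sub>i\<close> of hyperplanes strictly separating \<open>K\<close> from
  \<open>L\<^sub>i\<close> is open and nonempty, so it has positive intensity because the directional
  distribution charges every open set of directions (\<open>intensity_separators_pos\<close>); it is
  disjoint from \<open>B\<close>. If the sets \<open>A\<^sub>i\<close> were pairwise disjoint, the Poisson property would give a
  product of positive probabilities. In general they overlap, but they can be replaced by pairwise disjoint sets of
  positive intensity such that every \<open>A\<^sub>i\<close> contains one of them
  (\<open>disjoint_refinement\<close>); this strengthens the requirement.
\<close>

section \<open>Convex bodies\<close>

lemma hausdorff_dist_le_of_between:
  assumes "closed K" "K \<noteq> {}" "K \<subseteq> C" "C \<subseteq> {x. infdist x K \<le> \<epsilon>}" "0 \<le> \<epsilon>"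
  shows "hausdorff_dist K C \<le> \<epsilon>"
proof (rule hausdorff_dist_le)
  have "\<exists>y\<in>K. dist x y \<le> \<epsilon>" if "x \<in> C" for x
  proof -
    obtain y where "y \<in> K" "infdist x K = dist x y"
      using infdist_attains_inf[OF assms(1,2)] by blast
    moreover have "infdist x K \<le> \<epsilon>" using that assms(4) by auto
    ultimately show ?thesis by auto
  qed
  then show "\<epsilon> \<in> hausdorff_radii K C"
    using assms(3,5) by (force simp: hausdorff_radii_iff)
qed

lemma translate_mem_convex_bodies [simp]:
  fixes K :: "'a::euclidean_space set"
  shows "(+) x ` K \<in> convex_bodies \<longleftrightarrow> K \<in> convex_bodies"
proof -
  have "(+) y ` L \<in> convex_bodies" if "L \<in> convex_bodies" for y :: 'a and L
    using that by (auto simp: convex_bodies_def compact_translation convex_translation)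
  from this[of K x] this[of "(+) x ` K" "-x"] show ?thesis
    by (auto simp: image_image)
qed

lemma hausdorff_dist_translate_le:
  fixes K L :: "'a::euclidean_space set"
  assumes "K \<in> convex_bodies" "L \<in> convex_bodies"
  shows "hausdorff_dist ((+) x ` K) ((+) y ` L) \<le> hausdorff_dist K L + dist x y"
proof (rule hausdorff_dist_le)
  have *: "dist (a + k) (b + l) \<le> dist k l + dist a b" for a b k l :: 'a
    using dist_triangle_add[of a k b l] by simp
  have **: "\<exists>y\<in>B. dist (a + x) (b + y) \<le> \<eta> + dist a b" if "\<exists>y\<in>B. dist x y \<le> \<eta>"
    for a b x :: 'a and B \<eta>
    using that * by (meson add_right_mono order_trans)
  have "hausdorff_dist K L \<in> hausdorff_radii K L"
    by (rule hausdorff_dist_in_radii[OF assms])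
  then show "hausdorff_dist K L + dist x y \<in> hausdorff_radii ((+) x ` K) ((+) y ` L)"
    unfolding hausdorff_radii_iff using **[where a = x and b = y] **[where a = y and b = x] by (auto simp: dist_commute)
qed

text \<open>Continuity of the center function enters only here: it makes \<open>L \<mapsto> L - c(L)\<close> continuous,
  so that the bodies whose centered translate lies in an open set form an open set.\<close>

lemma openin_recentered_preimage:
  fixes c :: "'a::euclidean_space set \<Rightarrow> 'a"
  assumes c: "continuous_map convex_body_topology euclidean c"
    and V: "openin convex_body_topology V"
  shows "openin convex_body_topology {L \<in> convex_bodies. (+) (- c L) ` L \<in> V}"
  unfolding convex_body_topology_def Hausdorff.openin_mtopology
proof (intro conjI allI impI)
  fix L assume "L \<in> {L \<in> convex_bodies. (+) (- c L) ` L \<in> V}"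
  then have L: "L \<in> convex_bodies" and LV: "(+) (- c L) ` L \<in> V" by auto
  obtain s where s: "s > 0" "Hausdorff.mball ((+) (- c L) ` L) s \<subseteq> V"
    using V LV unfolding convex_body_topology_def Hausdorff.openin_mtopology by blast
  have "openin convex_body_topology {L' \<in> topspace convex_body_topology. c L' \<in> ball (c L) (s/2)}"
    using c by (rule openin_continuous_map_preimage) auto
  moreover have "L \<in> {L' \<in> topspace convex_body_topology. c L' \<in> ball (c L) (s/2)}"
    using L s by simp
  ultimately obtain r where r: "r > 0"
      "Hausdorff.mball L r \<subseteq> {L' \<in> topspace convex_body_topology. c L' \<in> ball (c L) (s/2)}"
    unfolding convex_body_topology_def Hausdorff.openin_mtopology by blast
  have "(+) (- c L') ` L' \<in> V"
    if L': "L' \<in> convex_bodies" "hausdorff_dist L L' < min r (s/2)" for L'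
  proof -
    have "dist (c L) (c L') < s/2" using r(2) L L' by (auto simp: subset_iff)
    moreover have "hausdorff_dist ((+) (- c L) ` L) ((+) (- c L') ` L')
        \<le> hausdorff_dist L L' + dist (- c L) (- c L')"
      by (rule hausdorff_dist_translate_le[OF L L'(1)])
    ultimately have "hausdorff_dist ((+) (- c L) ` L) ((+) (- c L') ` L') < s"
      using L'(2) by (simp add: dist_minus)
    then have "(+) (- c L') ` L' \<in> Hausdorff.mball ((+) (- c L) ` L) s"
      unfolding Hausdorff.in_mball translate_mem_convex_bodies using L L' by blast
    then show ?thesis using s(2) by blast
  qed
  then show "\<exists>r>0. Hausdorff.mball L r \<subseteq> {L \<in> convex_bodies. (+) (- c L) ` L \<in> V}"
    using r(1) s(1) by (intro exI[of _ "min r (s/2)"]) auto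
qed auto

section \<open>Cells of a system of hyperplanes\<close>

text \<open>A component is connected and avoids each hyperplane, so it lies strictly on one side of it.
  A segment between two of its points therefore also avoids all hyperplanes.\<close>

lemma convex_component_of_hyperplane_complement:
  fixes S :: "'a::euclidean_space set set"
  assumes S: "S \<subseteq> hyperplanes" and Z: "Z \<in> components (UNIV - \<Union>S)"
  shows "convex Z"
  unfolding convex_contains_segment
proof (intro ballI)
  fix x y assume xy: "x \<in> Z" "y \<in> Z"
  have "closed_segment x y \<inter> H = {}" if H: "H \<in> S" for H
  proof (rule ccontr)
    assume "closed_segment x y \<inter> H \<noteq> {}"
    moreover obtain a b where Hab: "H = {z. a \<bullet> z = b}"
      using H S by (auto simp: hyperplanes_def)
    ultimately obtain z where z: "z \<in> closed_segment x y" "a \<bullet> z = b" by auto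
    have ZH: "Z \<inter> H = {}" using in_components_subset[OF Z] H by auto
    have nb: "\<not> (a \<bullet> p \<le> b \<and> b \<le> a \<bullet> q)" if "p \<in> Z" "q \<in> Z" for p q
      using connected_ivt_hyperplane[OF in_components_connected[OF Z] that, of a b] ZH Hab by auto
    have "convex {z. a \<bullet> z < b}" "convex {z. a \<bullet> z > b}"
      by (auto intro: convex_halfspace_lt convex_halfspace_gt)
    then have "closed_segment x y \<subseteq> {z. a \<bullet> z < b} \<or> closed_segment x y \<subseteq> {z. a \<bullet> z > b}"
      using nb[OF xy(1) xy(2)] nb[OF xy(2) xy(1)] nb[OF xy(1) xy(1)]
      by (metis closed_segment_subset linorder_not_le mem_Collect_eq nle_le)
    then show False using z by auto
  qed
  then have "closed_segment x y \<subseteq> UNIV - \<Union>S" by auto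
  then show "closed_segment x y \<subseteq> Z"
    using components_maximal[OF Z] xy by (metis connected_segment(1) disjoint_iff ends_in_segment(1))
qed

definition hitting :: "'a::euclidean_space set \<Rightarrow> 'a set set" where
  "hitting K = {H \<in> hyperplanes. H \<inter> K \<noteq> {}}"

text \<open>For nonempty convex \<open>K\<close> and \<open>L\<close> these are the hyperplanes having \<open>K\<close> and \<open>L\<close> strictly on
  different sides. The formulation by segments does not mention a normal vector, so it is independent
  of which of the two unit normals represents the hyperplane.\<close>

definition separators :: "'a::euclidean_space set \<Rightarrow> 'a set \<Rightarrow> 'a set set" where
  "separators K L = {H \<in> hyperplanes. \<forall>k\<in>K. \<forall>l\<in>L. k \<notin> H \<and> l \<notin> H \<and> H \<inter> closed_segment k l \<noteq> {}}"

lemma hyperplane_mem_hyperplanes: "norm u = 1 \<Longrightarrow> hyperplane u \<tau> \<in> hyperplanes"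
  by (force simp: hyperplanes_eq)

lemma hyperplane_mem_hitting:
  assumes "norm u = 1"
  shows "hyperplane u \<tau> \<in> hitting K \<longleftrightarrow> (\<exists>k\<in>K. u \<bullet> k = \<tau>)"
  using hyperplane_mem_hyperplanes[OF assms, of \<tau>]
  by (auto simp: hitting_def hyperplane_eq[OF assms])

lemma hyperplane_meets_segment_iff:
  fixes u :: "'a::euclidean_space"
  shows "(u \<bullet> k \<noteq> \<tau> \<and> u \<bullet> l \<noteq> \<tau> \<and> {x. u \<bullet> x = \<tau>} \<inter> closed_segment k l \<noteq> {})
    \<longleftrightarrow> (u \<bullet> k - \<tau>) * (u \<bullet> l - \<tau>) < 0" (is "?L \<longleftrightarrow> ?R")
proof
  assume ?L
  then obtain z where z: "z \<in> closed_segment k l" "u \<bullet> z = \<tau>" and ne: "u \<bullet> k \<noteq> \<tau>" "u \<bullet> l \<noteq> \<tau>" by auto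
  show ?R
  proof (rule ccontr)
    assume "\<not> ?R"
    then have "(u \<bullet> k < \<tau> \<and> u \<bullet> l < \<tau>) \<or> (u \<bullet> k > \<tau> \<and> u \<bullet> l > \<tau>)"
      using ne by (auto simp: mult_less_0_iff not_less)
    then have "closed_segment k l \<subseteq> {z. u \<bullet> z < \<tau>} \<or> closed_segment k l \<subseteq> {z. u \<bullet> z > \<tau>}"
      by (metis closed_segment_subset convex_halfspace_gt convex_halfspace_lt mem_Collect_eq)
    then show False using z by auto
  qed
next
  assume R: ?R
  then have "\<exists>z\<in>closed_segment k l. u \<bullet> z = \<tau>"
    using connected_ivt_hyperplane[of "closed_segment k l" k l u \<tau>]
      connected_ivt_hyperplane[of "closed_segment k l" l k u \<tau>]
    by (auto simp: mult_less_0_iff)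
  then show ?L using R by auto
qed

text \<open>In terms of a unit normal, strict separation is one inequality for each pair of points, strict and
  continuous in all parameters. For compact sets this makes the condition open.\<close>

lemma hyperplane_mem_separators:
  assumes "norm u = 1"
  shows "hyperplane u \<tau> \<in> separators K L \<longleftrightarrow>
    (\<forall>k\<in>K. \<forall>l\<in>L. (u \<bullet> k - \<tau>) * (u \<bullet> l - \<tau>) < 0)"
  using hyperplane_mem_hyperplanes[OF assms, of \<tau>]
  unfolding separators_def hyperplane_eq[OF assms]
  by (simp add: hyperplane_meets_segment_iff[symmetric])

lemma connected_avoiding_separator:
  fixes Z :: "'a::euclidean_space set"
  assumes "H \<in> separators K L" "connected Z" "Z \<inter> H = {}" "Z \<inter> K \<noteq> {}"
  shows "Z \<inter> L = {}"
proof (rule ccontr)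
  assume "Z \<inter> L \<noteq> {}"
  then obtain k l where kl: "k \<in> Z" "k \<in> K" "l \<in> Z" "l \<in> L" using assms(4) by auto
  obtain u \<tau> where u: "norm u = 1" and H: "H = hyperplane u \<tau>"
    using assms(1) by (auto simp: separators_def hyperplanes_eq)
  have "(u \<bullet> k - \<tau>) * (u \<bullet> l - \<tau>) < 0"
    using assms(1) kl unfolding H hyperplane_mem_separators[OF u] by auto
  then have "\<exists>z\<in>Z. u \<bullet> z = \<tau>"
    using connected_ivt_hyperplane[OF assms(2) kl(1,3), of u \<tau>]
      connected_ivt_hyperplane[OF assms(2) kl(3,1), of u \<tau>]
    by (auto simp: mult_less_0_iff)
  then show False using assms(3) by (auto simp: H hyperplane_eq[OF u])
qed

text \<open>The deterministic core of the proof. The component containing \<open>K\<close> cannot reach the level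
  set \<open>{x. infdist x K = \<epsilon>}\<close>, as each point of the level set is cut off from \<open>K\<close> by a hyperplane.\<close>

lemma exists_cell_near_body:
  fixes K :: "'a::euclidean_space set"
  assumes K: "K \<in> convex_bodies" and "\<epsilon> > 0"
    and S: "S \<subseteq> hyperplanes" "S \<inter> hitting K = {}"
    and cover: "{x. infdist x K = \<epsilon>} \<subseteq> \<Union>\<L>"
    and sep: "\<And>L. L \<in> \<L> \<Longrightarrow> S \<inter> separators K L \<noteq> {}"
  shows "\<exists>C\<in>cells S. C \<in> convex_bodies \<and> hausdorff_dist K C \<le> \<epsilon>"
proof -
  have K': "K \<noteq> {}" "compact K" "convex K" using K by (auto simp: convex_bodies_def)
  have KS: "K \<subseteq> UNIV - \<Union>S" using S by (auto simp: hitting_def)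
  then obtain Z where Z: "Z \<in> components (UNIV - \<Union>S)" and KZ: "K \<subseteq> Z"
    using exists_component_superset[OF KS] K'(1,3) convex_connected by blast
  have conn: "connected Z" by (rule in_components_connected[OF Z])
  have ZK: "Z \<inter> K \<noteq> {}" using KZ K' by auto
  have "Z \<inter> L = {}" if "L \<in> \<L>" for L
  proof -
    obtain H where "H \<in> S" "H \<in> separators K L" using sep[OF \<open>L \<in> \<L>\<close>] by auto
    moreover have "Z \<inter> H = {}" using in_components_subset[OF Z] \<open>H \<in> S\<close> by auto
    ultimately show ?thesis using connected_avoiding_separator conn ZK by blast
  qed
  then have avoid: "infdist x K \<noteq> \<epsilon>" if "x \<in> Z" for x using cover that by blast
  \<comment> \<open>\<open>infdist _ K\<close> vanishes somewhere on the connected set \<open>Z\<close> and never takes the value \<open>\<epsilon>\<close>.\<close>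
  have "infdist x K \<le> \<epsilon>" if x: "x \<in> Z" for x
  proof (rule ccontr)
    assume "\<not> infdist x K \<le> \<epsilon>"
    obtain k where k: "k \<in> K" using K' by auto
    have "connected ((\<lambda>x. infdist x K) ` Z)"
      by (intro connected_continuous_image conn continuous_intros)
    moreover have "0 \<in> (\<lambda>x. infdist x K) ` Z" using k KZ by (force simp: image_iff)
    ultimately have "\<epsilon> \<in> (\<lambda>x. infdist x K) ` Z"
      using connectedD_interval[of "(\<lambda>x. infdist x K) ` Z" 0 "infdist x K" \<epsilon>] x
        \<open>\<not> infdist x K \<le> \<epsilon>\<close> \<open>\<epsilon> > 0\<close> by auto
    then show False using avoid by auto
  qed
  then have Z_sub: "Z \<subseteq> {x. infdist x K \<le> \<epsilon>}" by auto
  have "closed {x. infdist x K \<le> \<epsilon>}"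
    by (intro closed_Collect_le continuous_intros)
  then have clZ: "closure Z \<subseteq> {x. infdist x K \<le> \<epsilon>}" by (rule closure_minimal[OF Z_sub])
  have "compact {x. infdist x K \<le> \<epsilon>}"
    by (rule compact_infdist_le) (use K' \<open>\<epsilon> > 0\<close> in auto)
  then have "compact (closure Z)"
    using clZ by (meson bounded_subset closed_closure compact_eq_bounded_closed)
  moreover have "convex (closure Z)"
    by (intro convex_closure convex_component_of_hyperplane_complement[OF S(1) Z])
  ultimately have "closure Z \<in> convex_bodies"
    using KZ K' closure_subset[of Z] by (auto simp: convex_bodies_def)
  moreover have "hausdorff_dist K (closure Z) \<le> \<epsilon>"
    by (rule hausdorff_dist_le_of_between)
      (use K' KZ clZ closure_subset[of Z] \<open>\<epsilon> > 0\<close> in \<open>auto intro: compact_imp_closed\<close>)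
  moreover have "closure Z \<in> cells S" using Z by (auto simp: cells_def)
  ultimately show ?thesis by blast
qed

section \<open>Borel sets of hyperplanes\<close>

text \<open>The tube lemma in the form in which it yields open sets of hyperplane parameters.\<close>

lemma open_Collect_ball_compact:
  fixes W :: "('p::topological_space \<times> 'q::topological_space) set"
  assumes "compact K" "open W"
  shows "open {p. \<forall>y\<in>K. (p, y) \<in> W}"
proof (subst open_subopen, intro ballI)
  fix p assume "p \<in> {p. \<forall>y\<in>K. (p, y) \<in> W}"
  then have "{p} \<times> K \<subseteq> W" by auto
  then obtain X where "p \<in> X" "open X" "X \<times> K \<subseteq> W"
    using Elementary_Topology.tube_lemma[OF assms] by blast
  then show "\<exists>T. open T \<and> p \<in> T \<and> T \<subseteq> {p. \<forall>y\<in>K. (p, y) \<in> W}" by blast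
qed

lemma openin_hyperplane_topologyI:
  assumes "U \<subseteq> hyperplanes" "open G"
    and "\<And>u \<tau>. norm u = 1 \<Longrightarrow> hyperplane u \<tau> \<in> U \<longleftrightarrow> (u, \<tau>) \<in> G"
  shows "openin hyperplane_topology U"
proof -
  have "{(u, \<tau>) \<in> sphere 0 1 \<times> UNIV. hyperplane u \<tau> \<in> U} = (sphere 0 1 \<times> UNIV) \<inter> G"
    using assms(3) by auto
  then show ?thesis
    using assms(1,2) by (simp add: openin_hyperplane_topology openin_open_Int)
qed

lemma openin_imp_sets_borel_of: "openin T U \<Longrightarrow> U \<in> sets (borel_of T)"
  by (auto simp: sets_borel_of)

lemma separators_borel:
  fixes K L :: "'a::euclidean_space set"
  assumes "compact K" "compact L"
  shows "separators K L \<in> sets (borel_of hyperplane_topology)"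
proof (rule openin_imp_sets_borel_of, rule openin_hyperplane_topologyI)
  let ?W = "{q :: ('a \<times> real) \<times> ('a \<times> 'a).
     (fst (fst q) \<bullet> fst (snd q) - snd (fst q)) * (fst (fst q) \<bullet> snd (snd q) - snd (fst q)) < 0}"
  have "open ?W" by (intro open_Collect_less continuous_intros)
  then show "open {p. \<forall>y\<in>K \<times> L. (p, y) \<in> ?W}"
    by (intro open_Collect_ball_compact compact_Times assms)
  show "separators K L \<subseteq> hyperplanes" by (auto simp: separators_def)
  show "hyperplane u \<tau> \<in> separators K L \<longleftrightarrow> (u, \<tau>) \<in> {p. \<forall>y\<in>K \<times> L. (p, y) \<in> ?W}"
    if "norm u = 1" for u \<tau>
    by (simp add: hyperplane_mem_separators[OF that])
qed

lemma hitting_borel: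
  fixes K :: "'a::euclidean_space set"
  assumes "compact K"
  shows "hitting K \<in> sets (borel_of hyperplane_topology)"
proof -
  let ?W = "{q :: ('a \<times> real) \<times> 'a. fst (fst q) \<bullet> snd q \<noteq> snd (fst q)}"
  have "open ?W" by (intro open_Collect_neq continuous_intros)
  then have "open {p. \<forall>y\<in>K. (p, y) \<in> ?W}" by (intro open_Collect_ball_compact assms)
  then have "openin hyperplane_topology (hyperplanes - hitting K)"
    by (rule openin_hyperplane_topologyI[rotated])
      (auto simp: hyperplane_mem_hitting hyperplane_mem_hyperplanes)
  then have "space (borel_of hyperplane_topology) - (hyperplanes - hitting K)
      \<in> sets (borel_of hyperplane_topology)"
    by (intro sets.compl_sets openin_imp_sets_borel_of)
  moreover have "space (borel_of hyperplane_topology) - (hyperplanes - hitting K) = hitting K"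
    by (auto simp: hitting_def)
  ultimately show ?thesis by simp
qed

section \<open>The intensity measure\<close>

context
  fixes M :: "'w measure" and X :: "'w \<Rightarrow> 'a::euclidean_space set set" and \<phi> :: "'a measure"
  assumes sdd: "spherical_directional_distribution M X \<phi>"
begin

lemma space_directional_distribution: "space \<phi> = sphere 0 1"
  using sdd sets_eq_imp_space_eq[of \<phi> "borel_of (top_of_set (sphere 0 1))"]
  by (simp add: spherical_directional_distribution_def)

text \<open>A hyperplane that meets a ball of radius \<open>R\<close> around the origin has distance at most \<open>R\<close> from the
  origin, so the inner integral is at most \<open>2R\<close>.\<close>

lemma intensity_hitting_finite:
  assumes "bounded B" "A \<in> sets (borel_of hyperplane_topology)" "A \<subseteq> hitting B"
  shows "intensity M X A < \<infinity>"
proof -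
  interpret \<phi>: prob_space \<phi> using sdd by (simp add: spherical_directional_distribution_def)
  obtain R where R: "\<And>x. x \<in> B \<Longrightarrow> norm x \<le> R" using assms(1) by (auto simp: bounded_iff)
  obtain \<gamma> where \<gamma>: "intensity M X A =
      ennreal \<gamma> * (\<integral>\<^sup>+u. (\<integral>\<^sup>+\<tau>. indicator A (hyperplane u \<tau>) \<partial>lborel) \<partial>\<phi>)"
    using sdd assms(2) unfolding spherical_directional_distribution_def by blast
  have "(\<integral>\<^sup>+u. (\<integral>\<^sup>+\<tau>. indicator A (hyperplane u \<tau>) \<partial>lborel) \<partial>\<phi>)
      \<le> (\<integral>\<^sup>+u. (\<integral>\<^sup>+\<tau>. indicator {-R..R} \<tau> \<partial>lborel) \<partial>\<phi>)"
  proof (intro nn_integral_mono)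
    fix u \<tau> assume "u \<in> space \<phi>"
    then have u: "norm u = 1" by (simp add: space_directional_distribution)
    have "\<tau> \<in> {-R..R}" if hA: "hyperplane u \<tau> \<in> A"
    proof -
      obtain x where "x \<in> B" "u \<bullet> x = \<tau>"
        using subsetD[OF assms(3) hA] unfolding hyperplane_mem_hitting[OF u] by (elim bexE)
      moreover have "\<bar>u \<bullet> x\<bar> \<le> norm x" using Cauchy_Schwarz_ineq2[of u x] unfolding u by simp
      ultimately show ?thesis using R[of x] unfolding atLeastAtMost_iff by linarith
    qed
    then show "indicator A (hyperplane u \<tau>) \<le> (indicator {-R..R} \<tau> :: ennreal)"
      unfolding indicator_def by (simp del: atLeastAtMost_iff)
  qed
  also have "\<dots> = emeasure lborel {-R..R}" by (simp add: \<phi>.emeasure_space_1)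
  also have "\<dots> < \<infinity>" by (simp add: emeasure_lborel_Icc_eq)
  finally show ?thesis unfolding \<gamma> by (simp add: ennreal_mult_less_top)
qed

text \<open>One strictly separating hyperplane exists by the separation theorem. Strict separation persists for
  all normals \<open>u\<close> in a neighbourhood \<open>?U\<close> of its normal and all \<open>\<tau>\<close> in an interval of length \<open>2e\<close>,
  which gives the lower bound \<open>2 \<gamma> e \<cdot> \<phi>(?U)\<close>. This is where the full support of
  \<open>\<phi>\<close> is needed.\<close>

lemma intensity_separators_pos:
  fixes K L :: "'a set"
  assumes full: "measure_support (top_of_set (sphere 0 1)) \<phi> = sphere 0 1"
    and K: "compact K" "convex K" "K \<noteq> {}" and L: "compact L" "convex L" "L \<noteq> {}"
    and disj: "K \<inter> L = {}"
  shows "0 < intensity M X (separators K L)"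
proof -
  obtain \<gamma> where \<gamma>: "\<gamma> > 0" "intensity M X (separators K L) =
      ennreal \<gamma> * (\<integral>\<^sup>+u. (\<integral>\<^sup>+\<tau>. indicator (separators K L) (hyperplane u \<tau>) \<partial>lborel) \<partial>\<phi>)"
    using sdd separators_borel[OF K(1) L(1)] unfolding spherical_directional_distribution_def by blast
  obtain w s where w: "\<And>x. x \<in> K \<Longrightarrow> w \<bullet> x < s" "\<And>x. x \<in> L \<Longrightarrow> s < w \<bullet> x" "w \<noteq> 0"
  proof -
    obtain w s where ws: "\<forall>x\<in>K. w \<bullet> x < s" "\<forall>x\<in>L. s < w \<bullet> x"
      using separating_hyperplane_compact_closed[OF K(2,1,3) L(2) compact_imp_closed[OF L(1)] disj] by blast
    moreover have "w \<noteq> 0" using ws K(3) L(3) by fastforce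
    ultimately show ?thesis using that by blast
  qed
  define u0 where "u0 = w /\<^sub>R norm w"
  have u0: "norm u0 = 1" using w(3) by (simp add: u0_def)
  let ?W = "{q :: ('a \<times> real) \<times> ('a \<times> 'a).
     (fst (fst q) \<bullet> fst (snd q) - snd (fst q)) * (fst (fst q) \<bullet> snd (snd q) - snd (fst q)) < 0}"
  have "open ?W" by (intro open_Collect_less continuous_intros)
  define G where "G = {p. \<forall>y\<in>K \<times> L. (p, y) \<in> ?W}"
  have G: "open G"
    unfolding G_def by (intro open_Collect_ball_compact compact_Times K L \<open>open ?W\<close>)
  define t where "t = s / norm w"
  have "u0 \<bullet> k < t" if "k \<in> K" for k
    using w(1)[OF that] w(3) by (simp add: u0_def t_def field_simps)
  moreover have "t < u0 \<bullet> l" if "l \<in> L" for l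
    using w(2)[OF that] w(3) by (simp add: u0_def t_def field_simps)
  ultimately have "(u0, t) \<in> G" by (auto simp: G_def mult_less_0_iff)
  then obtain A T where "open A" "open T" "(u0, t) \<in> A \<times> T" and AT: "A \<times> T \<subseteq> G"
    by (rule open_prod_elim[OF G])
  then have A: "open A" "u0 \<in> A" and T: "open T" "t \<in> T" by auto
  obtain e where e: "e > 0" "{t - e .. t + e} \<subseteq> T"
    using T unfolding open_contains_cball cball_eq_atLeastAtMost by blast
  let ?U = "sphere 0 1 \<inter> A"
  have U: "openin (top_of_set (sphere 0 1)) ?U" by (simp add: openin_open_Int A)
  have U_pos: "0 < emeasure \<phi> ?U"
  proof -
    have "u0 \<in> measure_support (top_of_set (sphere 0 1)) \<phi>" using full u0 by simp
    then show ?thesis using U A(2) u0 by (auto simp: measure_support_def)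
  qed
  have U_sets: "?U \<in> sets \<phi>"
    using sdd openin_imp_sets_borel_of[OF U] by (simp add: spherical_directional_distribution_def)
  have "0 < ennreal (2 * e) * emeasure \<phi> ?U" using U_pos e by (simp add: ennreal_zero_less_mult_iff)
  also have "\<dots> = (\<integral>\<^sup>+u. ennreal (2 * e) * indicator ?U u \<partial>\<phi>)"
    using U_sets by (simp add: nn_integral_cmult_indicator)
  also have "\<dots> \<le> (\<integral>\<^sup>+u. (\<integral>\<^sup>+\<tau>. indicator (separators K L) (hyperplane u \<tau>) \<partial>lborel) \<partial>\<phi>)"
  proof (intro nn_integral_mono)
    fix u assume "u \<in> space \<phi>"
    then have u: "norm u = 1" by (simp add: space_directional_distribution)
    show "ennreal (2 * e) * indicator ?U u \<le> (\<integral>\<^sup>+\<tau>. indicator (separators K L) (hyperplane u \<tau>) \<partial>lborel)"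
    proof (cases "u \<in> ?U")
      case True
      have "ennreal (2 * e) * indicator ?U u = (\<integral>\<^sup>+\<tau>. indicator {t - e .. t + e} \<tau> \<partial>lborel)"
        using True e by simp
      also have "\<dots> \<le> (\<integral>\<^sup>+\<tau>. indicator (separators K L) (hyperplane u \<tau>) \<partial>lborel)"
      proof (intro nn_integral_mono)
        fix \<tau>
        have "hyperplane u \<tau> \<in> separators K L" if \<tau>: "\<tau> \<in> {t - e .. t + e}"
        proof -
          have "(u, \<tau>) \<in> A \<times> T" using \<tau> e(2) True by blast
          then have "(u, \<tau>) \<in> G" using AT by blast
          then show ?thesis by (simp add: G_def hyperplane_mem_separators[OF u])
        qed
        then show "indicator {t - e .. t + e} \<tau>
            \<le> (indicator (separators K L) (hyperplane u \<tau>) :: ennreal)"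
          unfolding indicator_def by (simp del: atLeastAtMost_iff)
      qed
      finally show ?thesis .
    qed simp
  qed
  finally show ?thesis using \<gamma> by (simp add: ennreal_zero_less_mult_iff)
qed

end

lemma intensity_mono: "A \<subseteq> B \<Longrightarrow> intensity M X A \<le> intensity M X B"
  unfolding intensity_def by (intro nn_integral_mono emeasure_mono) auto

section \<open>Configurations of positive probability\<close>

lemma counting_event:
  assumes "A \<in> sets (borel_of hyperplane_topology)" "B \<in> sets borel"
  shows "{S \<in> hyperplane_systems. num_elems (S \<inter> A) \<in> B} \<in> sets hyperplane_system_space"
  unfolding hyperplane_system_space_def using assms
  by (subst sets_measure_of) auto

lemma space_hyperplane_system_space [simp]: "space hyperplane_system_space = hyperplane_systems"
  unfolding hyperplane_system_space_def by (rule space_measure_of) auto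

context stationary_Poisson_hyperplane_process
begin

lemma count_measurable [measurable]:
  assumes "A \<in> sets (borel_of hyperplane_topology)"
  shows "(\<lambda>\<omega>. num_elems (X \<omega> \<inter> A)) \<in> borel_measurable M"
proof (rule measurableI)
  fix B :: "ennreal set" assume B: "B \<in> sets borel"
  have "(\<lambda>\<omega>. num_elems (X \<omega> \<inter> A)) -` B \<inter> space M
      = X -` {S \<in> hyperplane_systems. num_elems (S \<inter> A) \<in> B} \<inter> space M"
    using measurable_space[OF process_measurable] by auto
  also have "\<dots> \<in> sets M"
    by (rule measurable_sets[OF process_measurable counting_event[OF assms B]])
  finally show "(\<lambda>\<omega>. num_elems (X \<omega> \<inter> A)) -` B \<inter> space M \<in> sets M" .
qed simp

lemma intensity_eq_0_iff:
  assumes "A \<in> sets (borel_of hyperplane_topology)"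
  shows "intensity M X A = 0 \<longleftrightarrow> (AE \<omega> in M. X \<omega> \<inter> A = {})"
  unfolding intensity_def using assms
  by (simp add: nn_integral_0_iff_AE emeasure_count_space_eq_0)

text \<open>Independence is available only for pairwise disjoint sets. To take in a further set \<open>A\<close>, use
  the part of \<open>A\<close> outside the sets already chosen if it has positive intensity. Otherwise \<open>A\<close>
  meets one of the chosen sets in positive intensity, and that set is shrunk to its intersection with
  \<open>A\<close>, which does not harm the sets that contained it.\<close>

lemma disjoint_refinement:
  assumes "finite \<A>" "\<forall>A\<in>\<A>. A \<in> sets (borel_of hyperplane_topology) \<and> 0 < intensity M X A"
  shows "\<exists>\<D>. finite \<D> \<and> disjoint \<D> \<and> (\<forall>D\<in>\<D>. \<exists>A\<in>\<A>. D \<subseteq> A) \<and>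
    (\<forall>D\<in>\<D>. D \<in> sets (borel_of hyperplane_topology) \<and> 0 < intensity M X D) \<and>
    (\<forall>A\<in>\<A>. \<exists>D\<in>\<D>. D \<subseteq> A)"
  using assms
proof (induction \<A> rule: finite_induct)
  case empty
  then show ?case by (intro exI[of _ "{}"]) auto
next
  case (insert A \<A>)
  then obtain \<D> where \<D>: "finite \<D>" "disjoint \<D>" "\<forall>D\<in>\<D>. \<exists>A\<in>\<A>. D \<subseteq> A"
      "\<forall>D\<in>\<D>. D \<in> sets (borel_of hyperplane_topology) \<and> 0 < intensity M X D"
      "\<forall>A\<in>\<A>. \<exists>D\<in>\<D>. D \<subseteq> A"
    by blast
  have A: "A \<in> sets (borel_of hyperplane_topology)" "0 < intensity M X A" using insert.prems by auto
  have UD: "\<Union>\<D> \<in> sets (borel_of hyperplane_topology)"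
    using \<D>(1,4) by (intro sets.finite_Union) auto
  have "(\<exists>D\<in>\<D>. 0 < intensity M X (A \<inter> D)) \<or> 0 < intensity M X (A - \<Union>\<D>)"
  proof (rule ccontr)
    assume "\<not> ?thesis"
    then have "intensity M X (A - \<Union>\<D>) = 0" "\<forall>D\<in>\<D>. intensity M X (A \<inter> D) = 0"
      by (auto simp: not_less)
    then have "AE \<omega> in M. X \<omega> \<inter> (A - \<Union>\<D>) = {}" "\<forall>D\<in>\<D>. AE \<omega> in M. X \<omega> \<inter> (A \<inter> D) = {}"
      using A \<D>(4) UD intensity_eq_0_iff by (auto simp: sets.Int sets.Diff)
    then have "AE \<omega> in M. X \<omega> \<inter> (A - \<Union>\<D>) = {} \<and> (\<forall>D\<in>\<D>. X \<omega> \<inter> (A \<inter> D) = {})"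
      using \<D>(1) by (auto simp: AE_finite_all)
    then have "AE \<omega> in M. X \<omega> \<inter> A = {}" by eventually_elim blast
    then show False using A(2) intensity_eq_0_iff[OF A(1)] by simp
  qed
  then show ?case
  proof
    assume pos: "0 < intensity M X (A - \<Union>\<D>)"
    have "disjoint (insert (A - \<Union>\<D>) \<D>)"
      using \<D>(2) by (auto simp: pairwise_insert disjnt_def)
    then show ?thesis
      using \<D> pos A UD by (intro exI[of _ "insert (A - \<Union>\<D>) \<D>"]) (auto simp: sets.Diff)
  next
    assume "\<exists>D\<in>\<D>. 0 < intensity M X (A \<inter> D)"
    then obtain D where D: "D \<in> \<D>" "0 < intensity M X (A \<inter> D)" by blast
    let ?\<D> = "insert (A \<inter> D) (\<D> - {D})"
    have "disjoint ?\<D>"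
      using \<D>(2) D(1) unfolding pairwise_def disjnt_def by blast
    moreover have "\<exists>D'\<in>?\<D>. D' \<subseteq> A'" if A': "A' \<in> insert A \<A>" for A'
    proof (cases "A' = A")
      case False
      then obtain D' where "D' \<in> \<D>" "D' \<subseteq> A'" using A' \<D>(5) by auto
      then show ?thesis by (cases "D' = D") auto
    qed auto
    moreover have "\<forall>D'\<in>?\<D>. \<exists>A'\<in>insert A \<A>. D' \<subseteq> A'" using \<D>(3) by auto
    moreover have "\<forall>D\<in>?\<D>. D \<in> sets (borel_of hyperplane_topology) \<and> 0 < intensity M X D"
      using \<D>(4) D A by (auto simp: sets.Int)
    ultimately show ?thesis using \<D>(1) by (intro exI[of _ ?\<D>]) auto
  qed
qed

lemma prob_avoid_pos:
  assumes "A \<in> sets (borel_of hyperplane_topology)" "intensity M X A < \<infinity>"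
  shows "0 < \<P>(\<omega> in M. X \<omega> \<inter> A = {})"
  using Poisson_distributed[OF assms, of 0] by (simp add: emeasure_count_space_eq_0)

lemma prob_hit_pos:
  assumes "A \<in> sets (borel_of hyperplane_topology)" "intensity M X A < \<infinity>" "0 < intensity M X A"
  shows "0 < \<P>(\<omega> in M. X \<omega> \<inter> A \<noteq> {})"
proof -
  have "{\<omega> \<in> space M. num_elems (X \<omega> \<inter> A) = 0} \<in> events"
    using assms(1) by measurable
  then have "{\<omega> \<in> space M. X \<omega> \<inter> A = {}} \<in> events"
    by (simp add: emeasure_count_space_eq_0)
  then have "\<P>(\<omega> in M. X \<omega> \<inter> A \<noteq> {}) = 1 - \<P>(\<omega> in M. X \<omega> \<inter> A = {})"
    by (rule prob_neg)
  also have "\<dots> = 1 - exp (- enn2real (intensity M X A))"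
    using Poisson_distributed[OF assms(1,2), of 0] by (simp add: emeasure_count_space_eq_0)
  also have "\<dots> > 0" using assms(2,3) by (simp add: enn2real_positive_iff)
  finally show ?thesis .
qed

text \<open>Hitting every set of a disjoint refinement implies hitting all \<open>A \<in> \<A>\<close>. The probability of
  the stronger event is a product of factors \<open>1 - exp (-\<Theta>(D))\<close> and the factor
  \<open>exp (-\<Theta>(B))\<close>, all of them positive.\<close>

lemma prob_hit_all_avoid_pos:
  assumes "finite \<A>"
    and \<A>: "\<And>A. A \<in> \<A> \<Longrightarrow> A \<in> sets (borel_of hyperplane_topology) \<and>
      0 < intensity M X A \<and> intensity M X A < \<infinity> \<and> A \<inter> B = {}"
    and B: "B \<in> sets (borel_of hyperplane_topology)" "intensity M X B < \<infinity>"
  shows "\<exists>E\<in>events. 0 < prob E \<and>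
    (\<forall>\<omega>\<in>E. X \<omega> \<inter> B = {} \<and> (\<forall>A\<in>\<A>. X \<omega> \<inter> A \<noteq> {}))"
proof -
  have "\<forall>A\<in>\<A>. A \<in> sets (borel_of hyperplane_topology) \<and> 0 < intensity M X A"
    using \<A> by simp
  from disjoint_refinement[OF assms(1) this]
  obtain \<D> where \<D>: "finite \<D>" "disjoint \<D>" "\<forall>D\<in>\<D>. \<exists>A\<in>\<A>. D \<subseteq> A"
      "\<forall>D\<in>\<D>. D \<in> sets (borel_of hyperplane_topology) \<and> 0 < intensity M X D"
      "\<forall>A\<in>\<A>. \<exists>D\<in>\<D>. D \<subseteq> A"
    by (elim exE conjE)
  have D_props: "D \<in> sets (borel_of hyperplane_topology)" "0 < intensity M X D"
      "intensity M X D < \<infinity>" "D \<inter> B = {}" if D: "D \<in> \<D>" for D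
  proof -
    obtain A where A: "A \<in> \<A>" "D \<subseteq> A" using \<D>(3) D by blast
    show "D \<in> sets (borel_of hyperplane_topology)" "0 < intensity M X D" using \<D>(4) D by auto
    show "intensity M X D < \<infinity>"
      using intensity_mono[OF A(2), of M X] \<A>[OF A(1)] by (auto intro: le_less_trans)
    show "D \<inter> B = {}" using A \<A>[OF A(1)] by auto
  qed
  \<comment> \<open>Independence concerns a set of sets, so \<open>B\<close> has to be distinguishable from the sets to be hit.\<close>
  have BD: "B \<notin> \<D>"
  proof
    assume "B \<in> \<D>"
    from D_props(2,4)[OF this] have "B = {}" "0 < intensity M X B" by auto
    then show False by (simp add: intensity_def)
  qed
  define I where "I = insert B \<D>"
  \<comment> \<open>\<open>R A\<close> collects the admissible numbers of hyperplanes in \<open>A\<close>.\<close>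
  define R where "R A = (if A = B then {0} else - {0 :: ennreal})" for A
  define E where "E = (\<Inter>A\<in>I. (\<lambda>\<omega>. X \<omega> \<inter> A) -` {S \<in> hyperplane_systems. num_elems (S \<inter> A) \<in> R A} \<inter> space M)"
  have I: "finite I" "I \<noteq> {}" "I \<subseteq> sets (borel_of hyperplane_topology)" "disjoint I"
  proof -
    show "disjoint I"
      unfolding I_def using \<D>(2) D_props(4) by (auto simp: pairwise_insert disjnt_def)
  qed (use \<D>(1) D_props B in \<open>auto simp: I_def\<close>)
  have R: "{S \<in> hyperplane_systems. num_elems (S \<inter> A) \<in> R A} \<in> sets hyperplane_system_space"
    if "A \<in> I" for A
    by (rule counting_event) (use that I in \<open>auto simp: R_def\<close>)
  have indep: "indep_vars (\<lambda>_. hyperplane_system_space) (\<lambda>A \<omega>. X \<omega> \<inter> A) I"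
    by (rule independent_restrictions[OF I(3,4)])
  have systems: "X \<omega> \<inter> A \<in> hyperplane_systems" if "A \<in> I" "\<omega> \<in> space M" for A \<omega>
  proof -
    have "(\<lambda>\<omega>. X \<omega> \<inter> A) \<in> M \<rightarrow>\<^sub>M hyperplane_system_space"
      using indep that(1) by (auto simp: indep_vars_def)
    from measurable_space[OF this that(2)] show ?thesis by simp
  qed
  have E_eq: "(\<lambda>\<omega>. X \<omega> \<inter> A) -` {S \<in> hyperplane_systems. num_elems (S \<inter> A) \<in> R A} \<inter> space M
      = {\<omega> \<in> space M. if A = B then X \<omega> \<inter> A = {} else X \<omega> \<inter> A \<noteq> {}}" if "A \<in> I" for A
    using systems[OF that] by (auto simp: R_def Int_assoc emeasure_count_space_eq_0)
  have "prob E = (\<Prod>A\<in>I. prob ((\<lambda>\<omega>. X \<omega> \<inter> A) -` {S \<in> hyperplane_systems. num_elems (S \<inter> A) \<in> R A} \<inter> space M))"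
    unfolding E_def by (rule indep_varsD_finite[OF indep I(2,1) R])
  also have "\<dots> > 0"
  proof (rule prod_pos)
    fix A assume A: "A \<in> I"
    show "0 < prob ((\<lambda>\<omega>. X \<omega> \<inter> A) -` {S \<in> hyperplane_systems. num_elems (S \<inter> A) \<in> R A} \<inter> space M)"
      unfolding E_eq[OF A]
    proof (cases "A = B")
      case True
      then show "0 < \<P>(\<omega> in M. if A = B then X \<omega> \<inter> A = {} else X \<omega> \<inter> A \<noteq> {})"
        using prob_avoid_pos[OF B] by simp
    next
      case False
      then have AD: "A \<in> \<D>" using A by (simp add: I_def)
      from prob_hit_pos[OF D_props(1)[OF AD] D_props(3)[OF AD] D_props(2)[OF AD]] False
      show "0 < \<P>(\<omega> in M. if A = B then X \<omega> \<inter> A = {} else X \<omega> \<inter> A \<noteq> {})" by simp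
    qed
  qed
  finally have E_pos: "0 < prob E" .
  have E_mem: "if A = B then X \<omega> \<inter> A = {} else X \<omega> \<inter> A \<noteq> {}" if "\<omega> \<in> E" "A \<in> I" for \<omega> A
  proof -
    have "\<omega> \<in> {\<omega> \<in> space M. if A = B then X \<omega> \<inter> A = {} else X \<omega> \<inter> A \<noteq> {}}"
      unfolding E_eq[OF that(2), symmetric] using that unfolding E_def by (rule INT_D)
    then show ?thesis by (elim CollectE conjE)
  qed
  have "E \<in> events" using measure_notin_sets[of E M] E_pos by fastforce
  moreover have "X \<omega> \<inter> B = {} \<and> (\<forall>A\<in>\<A>. X \<omega> \<inter> A \<noteq> {})" if \<omega>: "\<omega> \<in> E" for \<omega>
  proof (intro conjI ballI)
    show "X \<omega> \<inter> B = {}" using E_mem[OF \<omega>, of B] by (simp add: I_def)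
  next
    fix A assume "A \<in> \<A>"
    then obtain D where D: "D \<in> \<D>" "D \<subseteq> A" using \<D>(5) by auto
    then have "X \<omega> \<inter> D \<noteq> {}"
      using E_mem[OF \<omega>, of D] BD by (auto simp: I_def split: if_splits)
    then show "X \<omega> \<inter> A \<noteq> {}" using D(2) by auto
  qed
  ultimately show ?thesis using E_pos by (intro bexI[of _ E]) simp_all
qed

text \<open>The event \<open>E\<close> is described by numbers of hyperplanes in Borel sets, so it is
  measurable because the process is; measurability of the condition on the cells is not at issue.\<close>

lemma event_cell_near_body:
  assumes \<phi>: "spherical_directional_distribution M X \<phi>"
    and full: "measure_support (top_of_set (sphere 0 1)) \<phi> = sphere 0 1"
    and K: "K \<in> convex_bodies" and \<epsilon>: "\<epsilon> > 0"
  shows "\<exists>E\<in>events. 0 < prob E \<and>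
    (\<forall>\<omega>\<in>E. \<exists>C\<in>cells (X \<omega>). C \<in> convex_bodies \<and> hausdorff_dist K C \<le> \<epsilon>)"
proof -
  have K': "K \<noteq> {}" "compact K" "convex K" using K by (auto simp: convex_bodies_def)
  let ?S = "{x. infdist x K = \<epsilon>}"
  have "compact ({x. infdist x K \<le> \<epsilon>} \<inter> ?S)"
    by (intro compact_Int_closed compact_infdist_le closed_Collect_eq continuous_intros)
      (use K' \<epsilon> in auto)
  moreover have "{x. infdist x K \<le> \<epsilon>} \<inter> ?S = ?S" by auto
  ultimately have cS: "compact ?S" by simp
  have "?S \<subseteq> (\<Union>x\<in>?S. ball x (\<epsilon>/2))" using \<epsilon> by auto
  then obtain F where F: "F \<subseteq> ?S" "finite F" "?S \<subseteq> (\<Union>x\<in>F. ball x (\<epsilon>/2))"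
    by (rule compactE_image[OF cS open_ball])
  define \<A> where "\<A> = (\<lambda>x. separators K (cball x (\<epsilon>/2))) ` F"
  have disj: "K \<inter> cball x (\<epsilon>/2) = {}" if "x \<in> F" for x
  proof -
    have "infdist x K = \<epsilon>" using that F(1) by auto
    then have "\<epsilon> \<le> dist x k" if "k \<in> K" for k using infdist_le[OF that, of x] by simp
    then show ?thesis using \<epsilon> by force
  qed
  have sep_props: "A \<in> sets (borel_of hyperplane_topology) \<and> 0 < intensity M X A \<and>
      intensity M X A < \<infinity> \<and> A \<inter> hitting K = {}" if A: "A \<in> \<A>" for A
  proof -
    obtain x where x: "x \<in> F" "A = separators K (cball x (\<epsilon>/2))" using A by (auto simp: \<A>_def)
    obtain k where k: "k \<in> K" using K' by auto
    have xx: "x \<in> cball x (\<epsilon>/2)" using \<epsilon> by simp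
    \<comment> \<open>A separating hyperplane meets the segment \<open>[k, x]\<close>, which bounds the intensity.\<close>
    have borel: "A \<in> sets (borel_of hyperplane_topology)"
      unfolding x(2) by (rule separators_borel) (use K' in auto)
    moreover have "0 < intensity M X A"
      unfolding x(2) by (rule intensity_separators_pos[OF \<phi> full]) (use K' \<epsilon> disj[OF x(1)] in auto)
    moreover have "A \<subseteq> hitting (closed_segment k x)"
      using k xx by (auto simp: x(2) separators_def hitting_def)
    then have "intensity M X A < \<infinity>"
      by (rule intensity_hitting_finite[OF \<phi> bounded_closed_segment borel])
    moreover have "A \<inter> hitting K = {}"
      unfolding x(2) separators_def hitting_def using xx by blast
    ultimately show ?thesis by blast
  qed
  have K_borel: "hitting K \<in> sets (borel_of hyperplane_topology)" by (rule hitting_borel[OF K'(2)])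
  have K_finite: "intensity M X (hitting K) < \<infinity>"
    by (rule intensity_hitting_finite[OF \<phi> compact_imp_bounded[OF K'(2)] K_borel subset_refl])
  have fin: "finite \<A>" using F(2) by (simp add: \<A>_def)
  obtain E where E: "E \<in> events" "0 < prob E"
      "\<forall>\<omega>\<in>E. X \<omega> \<inter> hitting K = {} \<and> (\<forall>A\<in>\<A>. X \<omega> \<inter> A \<noteq> {})"
    using prob_hit_all_avoid_pos[OF fin sep_props K_borel K_finite] by auto
  show ?thesis
  proof (intro bexI[OF _ E(1)] conjI ballI E(2))
    fix \<omega> assume \<omega>: "\<omega> \<in> E"
    have "\<omega> \<in> space M" using \<omega> E(1) sets.sets_into_space by blast
    then have "X \<omega> \<in> hyperplane_systems"
      using measurable_space[OF process_measurable] by simp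
    then have "X \<omega> \<subseteq> hyperplanes" by (simp add: hyperplane_systems_def)
    then show "\<exists>C\<in>cells (X \<omega>). C \<in> convex_bodies \<and> hausdorff_dist K C \<le> \<epsilon>"
    proof (rule exists_cell_near_body[OF K \<epsilon>])
      show "?S \<subseteq> \<Union>((\<lambda>x. cball x (\<epsilon>/2)) ` F)"
        by (rule order_trans[OF F(3)]) (rule UN_mono[OF subset_refl ball_subset_cball])
      show "X \<omega> \<inter> separators K L \<noteq> {}" if "L \<in> (\<lambda>x. cball x (\<epsilon>/2)) ` F" for L
        using that E(3) \<omega> by (auto simp: \<A>_def)
      show "X \<omega> \<inter> hitting K = {}" using E(3) \<omega> by simp
    qed
  qed
qed

end

section \<open>The support of the typical cell\<close>

text \<open>The integrand of \<^const>\<open>intensity\<close> may fail to be measurable here, but the integral still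
  dominates that of every measurable minorant, in particular that of the indicator of \<open>E\<close>.\<close>

lemma intensity_pos:
  assumes "E \<in> sets M" "0 < emeasure M E" "\<And>\<omega>. \<omega> \<in> E \<Longrightarrow> Y \<omega> \<inter> A \<noteq> {}"
  shows "0 < intensity M Y A"
proof -
  have "indicator E \<omega> \<le> num_elems (Y \<omega> \<inter> A)" for \<omega>
  proof (cases "\<omega> \<in> E")
    case True
    then obtain C where "{C} \<subseteq> Y \<omega> \<inter> A" using assms(3) by blast
    from emeasure_mono[OF this, of "count_space UNIV"] show ?thesis using True by simp
  qed simp
  then have "(\<integral>\<^sup>+\<omega>. indicator E \<omega> \<partial>M) \<le> intensity M Y A"
    unfolding intensity_def by (intro nn_integral_mono)
  then show ?thesis using assms by (auto intro: less_le_trans)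
qed

theorem theorem3:
  fixes M :: "'w measure"
    and X_hat :: "'w \<Rightarrow> 'a::euclidean_space set set"
    and \<phi> :: "'a measure"
    and c :: "'a set \<Rightarrow> 'a"
    and Q :: "'a set measure"
  assumes "stationary_Poisson_hyperplane_process M X_hat"
    and "locally_finite_intensity M X_hat"
    and "intensity M X_hat hyperplanes \<noteq> 0"
    and "spherical_directional_distribution M X_hat \<phi>"
    and "center_function c"
    and "typical_cell_distribution M (\<lambda>\<omega>. cells (X_hat \<omega>)) c Q"
    and "measure_support (top_of_set (sphere 0 1)) \<phi> = sphere 0 1"
  shows "measure_support (centered_body_topology c) Q = centered_bodies c"
proof -
  interpret stationary_Poisson_hyperplane_process M X_hat by fact
  have "0 < emeasure Q U" if U: "openin (centered_body_topology c) U" and K: "K \<in> U" for U K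
  proof (rule ccontr)
    assume "\<not> 0 < emeasure Q U"
    then have QU: "emeasure Q U = 0" by simp
    have setsQ: "sets Q = sets (borel_of (centered_body_topology c))"
      using assms(6) by (simp add: typical_cell_distribution_def)
    have U_sets: "U \<in> sets Q" using openin_imp_sets_borel_of[OF U] setsQ by simp
    have spaceQ: "space Q = centered_bodies c" using sets_eq_imp_space_eq[OF setsQ] by simp
    obtain V where V: "openin convex_body_topology V" "U = V \<inter> centered_bodies c"
      using U by (auto simp: centered_body_topology_def openin_subtopology)
    have Kc: "K \<in> convex_bodies" "c K = 0" using K V by (auto simp: centered_bodies_def)
    \<comment> \<open>\<open>A\<close> is invariant under translations, so the inner integral in the formula for its intensity is
      \<open>\<infinity>\<close> or \<open>0\<close>, according to whether \<open>C\<close> lies in \<open>U\<close>. With \<open>\<infinity> * 0 = 0\<close> the intensity vanishes.\<close>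
    define A where "A = {L \<in> convex_bodies. (+) (- c L) ` L \<in> V}"
    have A_open: "openin convex_body_topology A"
      unfolding A_def using assms(5) V(1)
      by (intro openin_recentered_preimage) (auto simp: center_function_def)
    obtain \<gamma> where "intensity M (\<lambda>\<omega>. cells (X_hat \<omega>)) A =
        ennreal \<gamma> * (\<integral>\<^sup>+C. (\<integral>\<^sup>+x. indicator A ((+) x ` C) \<partial>lborel) \<partial>Q)"
      using assms(6) openin_imp_sets_borel_of[OF A_open]
      unfolding typical_cell_distribution_def by blast
    also have "(\<integral>\<^sup>+C. (\<integral>\<^sup>+x. indicator A ((+) x ` C) \<partial>lborel) \<partial>Q)
        = (\<integral>\<^sup>+C. emeasure lborel (UNIV :: 'a set) * indicator U C \<partial>Q)"
    proof (rule nn_integral_cong)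
      fix C assume "C \<in> space Q"
      then have C: "C \<in> convex_bodies" "c C = 0" by (auto simp: spaceQ centered_bodies_def)
      then have "c ((+) x ` C) = x" for x using assms(5) by (simp add: center_function_def)
      then have "indicator A ((+) x ` C) = (indicator U C :: ennreal)" for x
        using C V(2) by (auto simp: A_def indicator_def image_image centered_bodies_def)
      then show "(\<integral>\<^sup>+x. indicator A ((+) x ` C) \<partial>lborel) = emeasure lborel (UNIV :: 'a set) * indicator U C"
        by (simp add: mult.commute)
    qed
    also have "\<dots> = emeasure lborel (UNIV :: 'a set) * emeasure Q U"
      using U_sets by (rule nn_integral_cmult_indicator)
    finally have null: "intensity M (\<lambda>\<omega>. cells (X_hat \<omega>)) A = 0" using QU by simp
    have "K \<in> A" using Kc K V by (simp add: A_def)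
    then obtain r where r: "r > 0" "Hausdorff.mball K r \<subseteq> A"
      using A_open unfolding convex_body_topology_def Hausdorff.openin_mtopology by blast
    obtain E where E: "E \<in> events" "0 < prob E"
        "\<forall>\<omega>\<in>E. \<exists>C\<in>cells (X_hat \<omega>). C \<in> convex_bodies \<and> hausdorff_dist K C \<le> r/2"
      using event_cell_near_body[OF assms(4,7) Kc(1), of "r/2"] r(1) by auto
    have "0 < intensity M (\<lambda>\<omega>. cells (X_hat \<omega>)) A"
    proof (rule intensity_pos[OF E(1)])
      show "0 < emeasure M E" using E(2) by (simp add: emeasure_eq_measure)
      fix \<omega> assume "\<omega> \<in> E"
      with E(3) obtain C where "C \<in> cells (X_hat \<omega>)" "C \<in> convex_bodies" "hausdorff_dist K C \<le> r/2"
        by blast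
      moreover from this have "C \<in> A" using r Kc(1) by (auto simp: subset_iff)
      ultimately show "cells (X_hat \<omega>) \<inter> A \<noteq> {}" by blast
    qed
    then show False using null by simp
  qed
  then show ?thesis by (auto simp: measure_support_def)
qed

end
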